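(* Let $(\alpha_k)_{k\ge1}$ be any sequence of real numbers in $]0,1[$ and let $(r_k)_{k\in\mathbb N}$ be the associated generalized Rademacher sequence. Then $(r_k)_{k\in\mathbb N}$ is a sequence of independent random variables on $([0,1],\mathcal B([0,1]),\lambda)$, where $\lambda$ is Lebesgue measure.
   Context: Generalized Rademacher sequence: put $a_0^0=0$, $a_1^0=1$, and for $k\ge0$ and $0\le j\le 2^k-1$ define recursively $a_{2j}^{k+1}=a_j^k$, $a_{2j+1}^{k+1}=a_j^k+\alpha_{k+1}(a_{j+1}^k-a_j^k)$, and $a_{2^{k+1}}^{k+1}=1$. (At each step every interval is cut in the proportions $\alpha_{k+1}$ and $1-\alpha_{k+1}$.) Then $r_0=1$ and, for $k\ge1$, $r_k=\sum_{j=0}^{2^k-1}(-1)^j\,1_{]a_j^k,a_{j+1}^k]}$. A sequence of random variables is called independent if for all indices $k_1<\dots<k_N$ the variables with these indices are mutually independent. *)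

theory Defs
  imports "HOL-Probability.Probability"
begin

text \<open>\<open>rademacher_pt \<alpha> k j\<close> is the division point \<open>a\<^sub>j\<^sup>k\<close>; only the indices \<open>j \<le> 2 ^ k\<close> are
  meaningful. The sequence \<open>\<alpha>\<close> is indexed from 1: the value \<open>\<alpha> 0\<close> is never used.
  Even and odd indices are treated through \<open>j div 2\<close>; the index-wise recursion, including the
  right end point, is given by the lemmas below.\<close>

fun rademacher_pt :: "(nat \<Rightarrow> real) \<Rightarrow> nat \<Rightarrow> nat \<Rightarrow> real" where
  "rademacher_pt \<alpha> 0 j = (if j = 0 then 0 else 1)"
| "rademacher_pt \<alpha> (Suc k) j =
    (if even j then rademacher_pt \<alpha> k (j div 2)
     else rademacher_pt \<alpha> k (j div 2)
       + \<alpha> (Suc k) * (rademacher_pt \<alpha> k (j div 2 + 1) - rademacher_pt \<alpha> k (j div 2)))"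

lemma rademacher_pt_even:
  "rademacher_pt \<alpha> (k + 1) (2 * j) = rademacher_pt \<alpha> k j"
  by simp

lemma rademacher_pt_odd:
  "rademacher_pt \<alpha> (k + 1) (2 * j + 1) = rademacher_pt \<alpha> k j
     + \<alpha> (k + 1) * (rademacher_pt \<alpha> k (j + 1) - rademacher_pt \<alpha> k j)"
  by simp

lemma rademacher_pt_left: "rademacher_pt \<alpha> k 0 = 0"
  by (induction k) auto

lemma rademacher_pt_right: "rademacher_pt \<alpha> k (2 ^ k) = 1"
  by (induction k) auto

definition gen_rademacher :: "(nat \<Rightarrow> real) \<Rightarrow> nat \<Rightarrow> real \<Rightarrow> real" where
  "gen_rademacher \<alpha> k x =
    (if k = 0 then 1
     else \<Sum>j = 0..2 ^ k - 1.
       (- 1) ^ j * indicator {rademacher_pt \<alpha> k j <.. rademacher_pt \<alpha> k (j + 1)} x)"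

end

theory Submission
  imports Defs
begin

text \<open>The intervals of level \<open>n\<close> partition \<open>]0,1]\<close>, and \<open>r\<^sub>k\<close> is constant on each of them as soon
  as \<open>k \<le> n\<close>. Every one of them is split by level \<open>n + 1\<close> in the same proportions
  \<open>\<alpha>\<^sub>n\<^sub>+\<^sub>1\<close> and \<open>1 - \<alpha>\<^sub>n\<^sub>+\<^sub>1\<close>, so the conditional law of \<open>r\<^sub>n\<^sub>+\<^sub>1\<close> given \<open>r\<^sub>0, \<dots>, r\<^sub>n\<close> is constant.\<close>

section \<open>Lebesgue measure on the unit interval\<close>

abbreviation unit_lborel :: "real measure" where
  "unit_lborel \<equiv> restrict_space lborel {0..1}"

lemma prob_space_unit_lborel: "prob_space unit_lborel"
  by (rule prob_space_restrict_space) auto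

lemma measure_unit_lborel_Ioc:
  assumes "0 \<le> a" "a \<le> b" "b \<le> 1"
  shows "measure unit_lborel {a<..b} = b - a"
proof -
  have "{a<..b} \<subseteq> {0..1}"
    using assms by auto
  then show ?thesis
    using assms by (simp add: measure_restrict_space)
qed

section \<open>Cells of a level and the events they determine\<close>

definition cell :: "(nat \<Rightarrow> real) \<Rightarrow> nat \<Rightarrow> nat \<Rightarrow> real set" where
  "cell \<alpha> k j = {rademacher_pt \<alpha> k j <.. rademacher_pt \<alpha> k (j + 1)}"

text \<open>Plays the part of measurability with respect to the first \<open>k\<close> subdivisions.
  Points outside all cells, such as 0, are left unconstrained, so no separate care is needed for
  this null set.\<close>

definition cell_saturated :: "(nat \<Rightarrow> real) \<Rightarrow> nat \<Rightarrow> real set \<Rightarrow> bool" where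
  "cell_saturated \<alpha> k B \<longleftrightarrow> (\<forall>j<2 ^ k. cell \<alpha> k j \<subseteq> B \<or> cell \<alpha> k j \<inter> B = {})"

lemma cell_saturated_INT:
  assumes "\<And>i. i \<in> J \<Longrightarrow> cell_saturated \<alpha> k (B i)"
  shows "cell_saturated \<alpha> k (\<Inter>i\<in>J. B i)"
  using assms unfolding cell_saturated_def by blast

lemma cell_saturated_Int:
  "cell_saturated \<alpha> k A \<Longrightarrow> cell_saturated \<alpha> k B \<Longrightarrow> cell_saturated \<alpha> k (A \<inter> B)"
  unfolding cell_saturated_def by blast

lemma gen_rademacher_borel_measurable [measurable]:
  "gen_rademacher \<alpha> k \<in> borel_measurable borel"
  unfolding gen_rademacher_def by measurable

locale rademacher_ratios =
  fixes \<alpha> :: "nat \<Rightarrow> real"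
  assumes ratio: "\<And>k. k \<ge> 1 \<Longrightarrow> \<alpha> k \<in> {0<..<1}"
begin

section \<open>Order of the division points and lengths of the cells\<close>

lemma pt_less_Suc: "j < 2 ^ k \<Longrightarrow> rademacher_pt \<alpha> k j < rademacher_pt \<alpha> k (Suc j)"
proof (induction k arbitrary: j)
  case (Suc k)
  define i where "i = j div 2"
  have "i < 2 ^ k"
    using Suc.prems by (auto simp: i_def)
  then have less: "rademacher_pt \<alpha> k i < rademacher_pt \<alpha> k (Suc i)"
    by (rule Suc.IH)
  have \<alpha>: "0 < \<alpha> (Suc k)" "\<alpha> (Suc k) < 1"
    using ratio[of "Suc k"] by auto
  let ?d = "rademacher_pt \<alpha> k (Suc i) - rademacher_pt \<alpha> k i"
  \<comment> \<open>The new point lies strictly inside the old interval: the first inequality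
    settles even \<open>j\<close>, the second odd \<open>j\<close>. The factor 1 is kept so that the
    monotonicity rule for products matches.\<close>
  have "0 < \<alpha> (Suc k) * ?d" "\<alpha> (Suc k) * ?d < 1 * ?d"
    using less \<alpha> by (auto intro!: mult_strict_right_mono simp del: mult_1)
  then show ?case
    by (cases "even j") (auto simp: i_def)
qed auto

lemma pt_mono:
  assumes "i \<le> j" "j \<le> 2 ^ k"
  shows "rademacher_pt \<alpha> k i \<le> rademacher_pt \<alpha> k j"
  using assms
proof (induction j rule: dec_induct)
  case (step j)
  then show ?case
    using pt_less_Suc[of j k] by auto
qed auto

lemma pt_bounds:
  assumes "j \<le> 2 ^ k"
  shows "0 \<le> rademacher_pt \<alpha> k j" "rademacher_pt \<alpha> k j \<le> 1"
  using pt_mono[of 0 j k] pt_mono[of j "2 ^ k" k] assms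
  by (auto simp: rademacher_pt_left rademacher_pt_right)

lemma cell_disjoint:
  assumes "x \<in> cell \<alpha> k i" "x \<in> cell \<alpha> k j" "i < 2 ^ k" "j < 2 ^ k"
  shows "i = j"
proof (rule ccontr)
  assume "i \<noteq> j"
  then consider "i + 1 \<le> j" | "j + 1 \<le> i"
    by linarith
  then show False
    using assms pt_mono[of "i + 1" j k] pt_mono[of "j + 1" i k]
    by cases (auto simp: cell_def)
qed

lemma cell_subset: "j < 2 ^ k \<Longrightarrow> cell \<alpha> k j \<subseteq> {0<..1}"
  using pt_bounds(1)[of j k] pt_bounds(2)[of "j + 1" k] by (auto simp: cell_def)

lemma cell_split:
  assumes "j < 2 ^ k"
  shows "cell \<alpha> k j = cell \<alpha> (Suc k) (2 * j) \<union> cell \<alpha> (Suc k) (Suc (2 * j))"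
  using pt_less_Suc[of "2 * j" "Suc k"] pt_less_Suc[of "Suc (2 * j)" "Suc k"] assms
  by (auto simp: cell_def)

lemma exists_cell:
  assumes "x \<in> {0<..1}"
  shows "\<exists>j<2 ^ k. x \<in> cell \<alpha> k j"
proof (induction k)
  case 0
  then show ?case
    using assms by (auto simp: cell_def)
next
  case (Suc k)
  then obtain j where "j < 2 ^ k" "x \<in> cell \<alpha> k j"
    by blast
  then have "2 * j < 2 ^ Suc k" "Suc (2 * j) < 2 ^ Suc k"
      "x \<in> cell \<alpha> (Suc k) (2 * j) \<or> x \<in> cell \<alpha> (Suc k) (Suc (2 * j))"
    using cell_split[of j k] by auto
  then show ?case
    by blast
qed

lemma measure_cell:
  assumes "j < 2 ^ k"
  shows "measure unit_lborel (cell \<alpha> k j) = rademacher_pt \<alpha> k (Suc j) - rademacher_pt \<alpha> k j"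
  unfolding cell_def
  using assms pt_bounds(1)[of j k] pt_bounds(2)[of "Suc j" k] pt_less_Suc[of j k]
  by (subst measure_unit_lborel_Ioc) auto

text \<open>The source of independence: the two proportions are the same for every cell
  \<open>j\<close> of level \<open>k\<close>.\<close>

lemma measure_cell_Suc:
  assumes "j < 2 ^ k"
  shows "measure unit_lborel (cell \<alpha> (Suc k) (2 * j)) = \<alpha> (Suc k) * measure unit_lborel (cell \<alpha> k j)"
    and "measure unit_lborel (cell \<alpha> (Suc k) (Suc (2 * j))) =
      (1 - \<alpha> (Suc k)) * measure unit_lborel (cell \<alpha> k j)"
  using assms by (simp_all add: measure_cell algebra_simps)

lemma sets_cell: "j < 2 ^ k \<Longrightarrow> cell \<alpha> k j \<in> sets unit_lborel"
  using cell_subset[of j k] by (subst sets_restrict_space_iff) (auto simp: cell_def)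

section \<open>Constancy of the functions on cells\<close>

lemma gen_rademacher_eq_on_cell:
  assumes "x \<in> cell \<alpha> k j" "j < 2 ^ k"
  shows "gen_rademacher \<alpha> k x = (- 1) ^ j"
proof (cases "k = 0")
  case False
  have "gen_rademacher \<alpha> k x = (\<Sum>i = 0..2 ^ k - 1. (- 1) ^ i * indicator (cell \<alpha> k i) x)"
    using False by (simp add: gen_rademacher_def cell_def)
  also have "\<dots> = (\<Sum>i = 0..2 ^ k - 1. if i = j then (- 1) ^ j else 0)"
  proof (intro sum.cong refl)
    fix i :: nat
    assume "i \<in> {0..2 ^ k - 1}"
    \<comment> \<open>Subtraction on \<open>nat\<close> truncates, so passing from
      \<open>i \<le> 2 ^ k - 1\<close> to \<open>i < 2 ^ k\<close> requires \<open>2 ^ k\<close> to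
      be positive.\<close>
    moreover have "(0 :: nat) < 2 ^ k"
      by simp
    ultimately have "i < 2 ^ k"
      unfolding atLeastAtMost_iff by linarith
    then have "x \<in> cell \<alpha> k i \<longleftrightarrow> i = j"
      using assms cell_disjoint by blast
    then show "(- 1) ^ i * indicator (cell \<alpha> k i) x = (if i = j then (- 1) ^ j else (0 :: real))"
      using assms(1) by (simp add: indicator_def)
  qed
  also have "\<dots> = (- 1) ^ j"
    using assms(2) by (subst sum.delta) auto
  finally show ?thesis .
qed (use assms in \<open>auto simp: gen_rademacher_def\<close>)

text \<open>Each cell \<open>j\<close> of the finer level lies inside its parent
  \<open>j div 2\<close>, hence inherits the alternative from it.\<close>

lemma cell_saturated_Suc:
  assumes "cell_saturated \<alpha> k B"
  shows "cell_saturated \<alpha> (Suc k) B"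
  unfolding cell_saturated_def
proof (intro allI impI)
  fix j :: nat
  assume "j < 2 ^ Suc k"
  then have *: "j div 2 < 2 ^ k"
    by auto
  have "j = 2 * (j div 2) \<or> j = Suc (2 * (j div 2))"
    by presburger
  then have "cell \<alpha> (Suc k) j \<subseteq> cell \<alpha> k (j div 2)"
    using cell_split[OF *] by (metis Un_upper1 Un_upper2)
  then show "cell \<alpha> (Suc k) j \<subseteq> B \<or> cell \<alpha> (Suc k) j \<inter> B = {}"
    using assms * unfolding cell_saturated_def by blast
qed

text \<open>At level \<open>k\<close> the function is constant on each cell; refinement carries this
  to every later level.\<close>

lemma cell_saturated_gen_rademacher:
  assumes "k \<le> n"
  shows "cell_saturated \<alpha> n (gen_rademacher \<alpha> k -` A \<inter> {0..1})"
  using assms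
proof (induction n rule: dec_induct)
  case base
  show ?case
    unfolding cell_saturated_def
  proof (intro allI impI)
    fix j :: nat
    assume j: "j < 2 ^ k"
    have "cell \<alpha> k j \<subseteq> {0..1}"
      using cell_subset[OF j] by auto
    then show "cell \<alpha> k j \<subseteq> gen_rademacher \<alpha> k -` A \<inter> {0..1} \<or>
        cell \<alpha> k j \<inter> (gen_rademacher \<alpha> k -` A \<inter> {0..1}) = {}"
      using gen_rademacher_eq_on_cell[OF _ j] by (cases "(- 1) ^ j \<in> A") auto
  qed
qed (rule cell_saturated_Suc)

lemma sets_gen_rademacher:
  "A \<in> sets borel \<Longrightarrow> gen_rademacher \<alpha> k -` A \<inter> {0..1} \<in> sets unit_lborel"
  using measurable_sets[OF gen_rademacher_borel_measurable, of A \<alpha> k]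
  by (subst sets_restrict_space_iff) auto

section \<open>Conditional law of a function given the coarser cells\<close>

lemma measure_eq_sum_cells:
  assumes B: "B \<in> sets unit_lborel"
  shows "measure unit_lborel B = (\<Sum>j<2 ^ k. measure unit_lborel (B \<inter> cell \<alpha> k j))"
proof -
  interpret prob_space unit_lborel
    by (rule prob_space_unit_lborel)
  \<comment> \<open>The cells are open on the left, so 0 is the one point of the space that they
    miss; they partition it only almost everywhere.\<close>
  have "AE x in unit_lborel. x \<noteq> 0"
    using AE_lborel_singleton[of 0] by (subst AE_restrict_space_iff) auto
  then have "AE x in unit_lborel. (\<forall>j\<in>{..<2 ^ k}. x \<in> B \<inter> cell \<alpha> k j \<longrightarrow> x \<in> B) \<and>
      (x \<in> B \<longrightarrow> (\<exists>!j\<in>{..<2 ^ k}. x \<in> B \<inter> cell \<alpha> k j))"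
  proof (rule AE_mp, intro AE_I2 impI)
    fix x :: real
    assume "x \<in> space unit_lborel" "x \<noteq> 0"
    then have "x \<in> {0<..1}"
      by (auto simp: space_restrict_space)
    then show "(\<forall>j\<in>{..<2 ^ k}. x \<in> B \<inter> cell \<alpha> k j \<longrightarrow> x \<in> B) \<and>
      (x \<in> B \<longrightarrow> (\<exists>!j\<in>{..<2 ^ k}. x \<in> B \<inter> cell \<alpha> k j))"
      using exists_cell[of x k] cell_disjoint[of x k] by blast
  qed
  moreover have C: "B \<inter> cell \<alpha> k j \<in> events" if "j < 2 ^ k" for j
    using B sets_cell[OF that] by blast
  \<comment> \<open>Translates between plain sets and the comprehensions over the space in which
    \<open>prob_sum\<close> is stated.\<close>
  have eq: "{x \<in> space unit_lborel. x \<in> B'} = B'" if "B' \<in> events" for B'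
    using sets.sets_into_space[OF that] by blast
  ultimately have "prob {x \<in> space unit_lborel. x \<in> B} =
      (\<Sum>j<2 ^ k. prob {x \<in> space unit_lborel. x \<in> B \<inter> cell \<alpha> k j})"
    using B by (intro prob_sum) (simp_all only: eq C lessThan_iff finite_lessThan)
  also have "\<dots> = (\<Sum>j<2 ^ k. prob (B \<inter> cell \<alpha> k j))"
    by (intro sum.cong refl arg_cong[where f = prob] eq C) simp
  finally show ?thesis
    unfolding eq[OF B] .
qed

text \<open>The mass of \<open>A\<close> under the two-point law on 1 and -1, which for
  \<open>k \<ge> 1\<close> is the law of \<open>gen_rademacher \<alpha> k\<close>.\<close>

definition sign_weight :: "nat \<Rightarrow> real set \<Rightarrow> real" where
  "sign_weight k A = \<alpha> k * indicator A 1 + (1 - \<alpha> k) * indicator A (- 1)"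

text \<open>The left child has an even index and sign 1, the right child an odd index and sign -1.
  The event therefore cuts out of the parent a union of children, chosen by whether 1 and -1 belong
  to \<open>A\<close>.\<close>

lemma measure_cell_Int_gen_rademacher:
  assumes j: "j < 2 ^ n"
  shows "measure unit_lborel (cell \<alpha> n j \<inter> (gen_rademacher \<alpha> (Suc n) -` A \<inter> {0..1})) =
    sign_weight (Suc n) A * measure unit_lborel (cell \<alpha> n j)"
proof -
  interpret prob_space unit_lborel
    by (rule prob_space_unit_lborel)
  let ?L = "cell \<alpha> (Suc n) (2 * j)" and ?R = "cell \<alpha> (Suc n) (Suc (2 * j))"
  let ?E = "gen_rademacher \<alpha> (Suc n) -` A \<inter> {0..1}"
  have j2: "2 * j < 2 ^ Suc n" "Suc (2 * j) < 2 ^ Suc n"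
    using j by auto
  have L: "gen_rademacher \<alpha> (Suc n) x = 1" if "x \<in> ?L" for x
    using gen_rademacher_eq_on_cell[OF that j2(1)] by simp
  have R: "gen_rademacher \<alpha> (Suc n) x = - 1" if "x \<in> ?R" for x
    using gen_rademacher_eq_on_cell[OF that j2(2)] by simp
  have sub: "?L \<subseteq> {0..1}" "?R \<subseteq> {0..1}"
    using cell_subset[OF j2(1)] cell_subset[OF j2(2)] by auto
  have "?L \<inter> ?E = (if 1 \<in> A then ?L else {})" "?R \<inter> ?E = (if - 1 \<in> A then ?R else {})"
    using L R sub by auto
  then have "cell \<alpha> n j \<inter> ?E = (if 1 \<in> A then ?L else {}) \<union> (if - 1 \<in> A then ?R else {})"
    unfolding cell_split[OF j] Int_Un_distrib2 by (rule arg_cong2)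
  moreover have "?L \<inter> ?R = {}"
    using cell_disjoint[OF _ _ j2] by auto
  ultimately have "prob (cell \<alpha> n j \<inter> ?E) = indicator A 1 * prob ?L + indicator A (- 1) * prob ?R"
    using finite_measure_Union[OF sets_cell[OF j2(1)] sets_cell[OF j2(2)]]
    by (simp add: indicator_def)
  then show ?thesis
    unfolding measure_cell_Suc[OF j] sign_weight_def by (simp add: algebra_simps)
qed

text \<open>A cell of level \<open>n\<close> lies in \<open>B\<close> or misses it, so the previous
  formula applies cell by cell; its factor does not depend on the cell and comes out of the
  sum.\<close>

lemma measure_saturated_Int_gen_rademacher:
  assumes B: "B \<in> sets unit_lborel" "cell_saturated \<alpha> n B" and A: "A \<in> sets borel"
  shows "measure unit_lborel (B \<inter> (gen_rademacher \<alpha> (Suc n) -` A \<inter> {0..1})) =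
    sign_weight (Suc n) A * measure unit_lborel B"
proof -
  let ?E = "gen_rademacher \<alpha> (Suc n) -` A \<inter> {0..1}"
  have "measure unit_lborel ((B \<inter> ?E) \<inter> cell \<alpha> n j) =
      sign_weight (Suc n) A * measure unit_lborel (B \<inter> cell \<alpha> n j)" if j: "j < 2 ^ n" for j
  proof (cases "cell \<alpha> n j \<subseteq> B")
    case True
    then have "(B \<inter> ?E) \<inter> cell \<alpha> n j = cell \<alpha> n j \<inter> ?E" "B \<inter> cell \<alpha> n j = cell \<alpha> n j"
      by auto
    then show ?thesis
      using measure_cell_Int_gen_rademacher[OF j] by simp
  next
    case False
    then have "(B \<inter> ?E) \<inter> cell \<alpha> n j = {}" "B \<inter> cell \<alpha> n j = {}"
      using B(2) j unfolding cell_saturated_def by auto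
    then show ?thesis
      by simp
  qed
  moreover have "B \<inter> ?E \<in> sets unit_lborel"
    using B(1) sets_gen_rademacher[OF A] by blast
  ultimately show ?thesis
    using measure_eq_sum_cells[OF B(1), of n] measure_eq_sum_cells[of "B \<inter> ?E" n]
    by (simp add: sum_distrib_left)
qed

section \<open>Product formula for finitely many indices\<close>

lemma measure_INT_gen_rademacher:
  assumes "finite J" "\<And>j. j \<in> J \<Longrightarrow> A j \<in> sets borel"
  shows "measure unit_lborel ({0..1} \<inter> (\<Inter>j\<in>J. gen_rademacher \<alpha> j -` A j \<inter> {0..1})) =
    (\<Prod>j\<in>J. measure unit_lborel (gen_rademacher \<alpha> j -` A j \<inter> {0..1}))"
  using assms
\<comment> \<open>Adding the largest index \<open>k\<close> last makes all earlier constraints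
  saturated at level \<open>k - 1\<close>, so that the conditional law of the new function can be
  used.\<close>
proof (induction J rule: finite_linorder_max_induct)
  case empty
  \<comment> \<open>The extra factor \<open>{0..1}\<close> makes the empty intersection the whole
    space, of measure 1, instead of \<open>UNIV\<close>.\<close>
  show ?case
    by (simp add: measure_restrict_space)
next
  case (insert k J)
  let ?E = "\<lambda>j. gen_rademacher \<alpha> j -` A j \<inter> {0..1}"
  let ?B = "{0..1} \<inter> (\<Inter>j\<in>J. ?E j)"
  have "k \<notin> J"
    using insert.hyps by blast
  show ?case
  proof (cases k)
    case 0
    \<comment> \<open>No index lies below 0, so both sides reduce to a single factor.\<close>
    then have "J = {}"
      using insert.hyps by auto
    moreover have "{0..1} \<inter> ?E k = ?E k"
      by blast
    ultimately show ?thesis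
      by simp
  next
    case (Suc n)
    \<comment> \<open>The whole space is saturated, being the preimage of \<open>UNIV\<close> under
      the function of index 0.\<close>
    have I: "{0..1} \<in> sets unit_lborel" "cell_saturated \<alpha> n {0..1}"
      "measure unit_lborel {0..1} = 1"
      using cell_saturated_gen_rademacher[of 0 n UNIV]
      by (simp_all add: sets_restrict_space_iff measure_restrict_space)
    have "?B \<in> sets unit_lborel"
    proof (cases "J = {}")
      case False
      have "?E j \<in> sets unit_lborel" if "j \<in> J" for j
        using insert.prems that by (intro sets_gen_rademacher) auto
      then show ?thesis
        using I(1) False insert.hyps(1) by (intro sets.Int[OF I(1)] sets.finite_INT)
    qed (use I(1) in simp)
    moreover have "cell_saturated \<alpha> n ?B"
      using I(2) insert.hyps(2) Suc
      by (intro cell_saturated_Int cell_saturated_INT cell_saturated_gen_rademacher) auto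
    moreover have Ak: "A k \<in> sets borel"
      using insert.prems by simp
    ultimately have "measure unit_lborel (?B \<inter> ?E k) = sign_weight k (A k) * measure unit_lborel ?B"
      unfolding Suc by (intro measure_saturated_Int_gen_rademacher) auto
    \<comment> \<open>The marginal law is the conditional formula with the whole space in place of
      \<open>?B\<close>.\<close>
    moreover have "measure unit_lborel (?E k) = sign_weight k (A k)"
      using measure_saturated_Int_gen_rademacher[OF I(1,2) Ak] I(3) Suc
      by (simp add: Int_left_absorb Int_commute)
    moreover have "{0..1} \<inter> (\<Inter>j\<in>insert k J. ?E j) = ?B \<inter> ?E k"
      by blast
    ultimately show ?thesis
      using insert.IH insert.prems insert.hyps(1) \<open>k \<notin> J\<close> by simp
  qed
qed

end

theorem proposition1p3p1:
  fixes \<alpha> :: "nat \<Rightarrow> real"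
  assumes "\<And>k. k \<ge> 1 \<Longrightarrow> \<alpha> k \<in> {0<..<1}"
  shows "prob_space (restrict_space lborel {0..1::real}) \<and>
    prob_space.indep_vars (restrict_space lborel {0..1::real})
      (\<lambda>_. borel) (gen_rademacher \<alpha>) (UNIV :: nat set)"
proof -
  interpret rademacher_ratios \<alpha>
    by standard (rule assms)
  interpret prob_space unit_lborel
    by (rule prob_space_unit_lborel)
  have space: "space unit_lborel = {0..1}"
    by (simp add: space_restrict_space)
  have "indep_vars (\<lambda>_. borel) (gen_rademacher \<alpha>) UNIV"
    unfolding indep_vars_def2 space
  proof (intro conjI ballI indep_setsI)
    fix k
    show "random_variable borel (gen_rademacher \<alpha> k)"
      by (intro measurable_restrict_space1) simp
    show "{gen_rademacher \<alpha> k -` A \<inter> {0..1} |A. A \<in> sets borel} \<subseteq> events"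
      using sets_gen_rademacher by auto
  next
    fix E and J :: "nat set"
    assume J: "J \<noteq> {}" "finite J"
      and "\<forall>j\<in>J. E j \<in> {gen_rademacher \<alpha> j -` A \<inter> {0..1} |A. A \<in> sets borel}"
    then have "\<forall>j\<in>J. \<exists>A. A \<in> sets borel \<and> E j = gen_rademacher \<alpha> j -` A \<inter> {0..1}"
      by blast
    then obtain A where A: "\<And>j. j \<in> J \<Longrightarrow> A j \<in> sets borel"
      "\<And>j. j \<in> J \<Longrightarrow> E j = gen_rademacher \<alpha> j -` A j \<inter> {0..1}"
      by metis
    \<comment> \<open>Since \<open>J\<close> is nonempty, some \<open>E j\<close> already confines
      the intersection to \<open>{0..1}\<close>.\<close>
    have "(\<Inter>j\<in>J. E j) = {0..1} \<inter> (\<Inter>j\<in>J. gen_rademacher \<alpha> j -` A j \<inter> {0..1})"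
      using A(2) J(1) by auto
    then have "prob (\<Inter>j\<in>J. E j) = (\<Prod>j\<in>J. prob (gen_rademacher \<alpha> j -` A j \<inter> {0..1}))"
      using measure_INT_gen_rademacher[OF J(2) A(1)] by presburger
    also have "\<dots> = (\<Prod>j\<in>J. prob (E j))"
      using A(2) by (intro prod.cong) auto
    finally show "prob (\<Inter>j\<in>J. E j) = (\<Prod>j\<in>J. prob (E j))" .
  qed
  then show ?thesis
    using prob_space_unit_lborel by blast
qed

end
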